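(* Let $H$ be a finite-dimensional real Hilbert space and let $f:H\to\mathbb{R}$ be twice continuously differentiable and bounded below, with nonempty set of minimizers. Assume that for some $L_\nu>0$ and $\nu\in[0,1]$ one has $\|\nabla^2 f(x)-\nabla^2 f(y)\|\le L_\nu\|x-y\|^\nu$ for all $x,y\in H$. Let $(x_k)_k$ be generated by the basic inexact trust-region method (described in the context). Let $x_\star$ be a local minimizer of $f$, and suppose that $\nabla^2 f(x_\star)\succ0$ and $x_k\to x_\star$. Then there exist an index $K_0\in\mathbb{N}$ and a lower bound $\underline\Delta>0$ such that: (i) for all $k\ge K_0$ the step is very successful, i.e. $\rho_k\ge\eta_2$; (ii) for all $k\ge K_0$, $\Delta_k\ge\underline\Delta$; (iii) for all $k\ge K_0$, the exact trust-region solution satisfies $s_k^\star=-\nabla^2 f(x_k)^{-1}\nabla f(x_k)$, and both the computed and the exact step are strictly feasible, i.e. $\max\{\|s_k\|,\|s_k^\star\|\}<\Delta_k$; (iv) if $\nu=0$ and $\tau_k\le\|\nabla f(x_k)\|^2$ for all $k$, the method eventually converges Q-superlinearly, i.e. $\|x_{k+1}-x_\star\|=o(\|x_k-x_\star\|)$; (v) if $\nu\in(0,1]$ and $\tau_k\le\|\nabla f(x_k)\|^2$ for all $k$, then there exists a constant $C>0$ such that, for all sufficiently large $k$, $\|x_{k+1}-x_\star\|\le C\|x_k-x_\star\|^{1+\nu}$.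
   Context: $\mathbb{N}=\{0,1,2,\dots\}$. Write $g_k:=\nabla f(x_k)$, $H_k:=\nabla^2 f(x_k)$ and $m_k(s):=f(x_k)+\langle g_k,s\rangle+\tfrac12\langle H_ks,s\rangle$. Throughout, $s_k^\star$ denotes an arbitrary global solution of the subproblem, $s_k^\star\in\arg\min_{\|s\|\le\Delta_k}m_k(s)$. Basic inexact trust-region method. Inputs: $x_0\in H$, $\Delta_0>0$, constants $0<\eta_1\le\eta_2<1$, $0<\gamma_1\le\gamma_2<1\le\gamma_3$, a bound $\bar\tau>0$ and inexactness parameters $\tau_k\in[0,\bar\tau)$. For $k=0,1,2,\dots$: if $\|g_k\|=0$, terminate and return $x_k$. Otherwise compute a step $s_k\in H$ with $\|s_k\|\le\Delta_k$ and $$m_k(0)-m_k(s_k)\ge\frac{1}{1+\tau_k}\bigl(m_k(0)-m_k(s_k^\star)\bigr).$$ Set $\rho_k:=\dfrac{f(x_k)-f(x_k+s_k)}{m_k(0)-m_k(s_k)}$. Set $x_{k+1}=x_k+s_k$ if $\rho_k\ge\eta_1$ and $x_{k+1}=x_k$ otherwise. Choose $\Delta_{k+1}$ arbitrarily in $[\gamma_1\Delta_k,\gamma_2\Delta_k]$ if $\rho_k<\eta_1$, in $[\gamma_2\Delta_k,\Delta_k]$ if $\eta_1\le\rho_k<\eta_2$, and in $[\Delta_k,\gamma_3\Delta_k]$ if $\rho_k\ge\eta_2$. Standing convention: the method does not terminate finitely, i.e. $\|\nabla f(x_k)\|>0$ and $f(x_k)-\min f>0$ for all $k\in\mathbb{N}$.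 *)

theory Defs
  imports "HOL-Analysis.Analysis" "HOL-Library.Landau_Symbols"
begin

text \<open>The gradient \<open>g\<close> and the Hessian \<open>B\<close> are carried as functions tied to \<open>f\<close> by the
  following predicate, which determines both of them uniquely. The norm on
  \<^typ>\<open>'a \<Rightarrow>\<^sub>L 'a\<close> is the operator norm.\<close>

definition C2_with_grad_hess ::
    "('a::euclidean_space \<Rightarrow> real) \<Rightarrow> ('a \<Rightarrow> 'a) \<Rightarrow> ('a \<Rightarrow> ('a \<Rightarrow>\<^sub>L 'a)) \<Rightarrow> bool" where
  "C2_with_grad_hess f g B \<longleftrightarrow>
     (\<forall>x. GDERIV f x :> g x) \<and>
     (\<forall>x. (g has_derivative blinfun_apply (B x)) (at x)) \<and>
     continuous_on UNIV B"

definition local_minimizer :: "('a::euclidean_space \<Rightarrow> real) \<Rightarrow> 'a \<Rightarrow> bool" where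
  "local_minimizer f z \<longleftrightarrow> (\<forall>\<^sub>F y in nhds z. f z \<le> f y)"

text \<open>Symmetry is not part of the definition: it is only applied to Hessians of \<open>C\<^sup>2\<close> functions,
  which are self-adjoint anyway.\<close>

definition pos_def :: "('a::euclidean_space \<Rightarrow>\<^sub>L 'a) \<Rightarrow> bool" where
  "pos_def A \<longleftrightarrow> (\<forall>v. v \<noteq> 0 \<longrightarrow> blinfun_apply A v \<bullet> v > 0)"

text \<open>For \<open>\<nu> = 0\<close> and \<open>x = y\<close> the right-hand side is \<^term>\<open>0 powr 0 = (0::real)\<close> rather than \<open>L\<close>;
  this is harmless because the left-hand side vanishes there as well.\<close>

definition hoelder_with ::
    "real \<Rightarrow> real \<Rightarrow> ('a::euclidean_space \<Rightarrow> ('a \<Rightarrow>\<^sub>L 'a)) \<Rightarrow> bool" where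
  "hoelder_with L \<nu> B \<longleftrightarrow> (\<forall>x y. norm (B x - B y) \<le> L * norm (x - y) powr \<nu>)"

definition tr_model ::
    "('a::euclidean_space \<Rightarrow> real) \<Rightarrow> ('a \<Rightarrow> 'a) \<Rightarrow> ('a \<Rightarrow> ('a \<Rightarrow>\<^sub>L 'a)) \<Rightarrow> 'a \<Rightarrow> 'a \<Rightarrow> real" where
  "tr_model f g B x s = f x + g x \<bullet> s + 1/2 * (blinfun_apply (B x) s \<bullet> s)"

definition tr_solution ::
    "('a::euclidean_space \<Rightarrow> real) \<Rightarrow> ('a \<Rightarrow> 'a) \<Rightarrow> ('a \<Rightarrow> ('a \<Rightarrow>\<^sub>L 'a)) \<Rightarrow> 'a \<Rightarrow> real \<Rightarrow> 'a \<Rightarrow> bool" where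
  "tr_solution f g B x \<Delta> s \<longleftrightarrow> is_arg_min (tr_model f g B x) (\<lambda>t. norm t \<le> \<Delta>) s"

text \<open>Statements about all subproblem solutions are never vacuous:\<close>

lemma tr_solution_exists:
  assumes "\<Delta> \<ge> 0"
  shows "\<exists>s. tr_solution f g B x \<Delta> s"
proof -
  have "continuous_on (cball 0 \<Delta>) (tr_model f g B x)"
    unfolding tr_model_def by (intro continuous_intros)
  then obtain s where "s \<in> cball 0 \<Delta>" "\<forall>t\<in>cball 0 \<Delta>. tr_model f g B x s \<le> tr_model f g B x t"
    using continuous_attains_inf[of "cball 0 \<Delta>" "tr_model f g B x"] assms by auto
  then show ?thesis
    by (auto simp: tr_solution_def is_arg_min_linorder)
qed

definition tr_ratio ::
    "('a::euclidean_space \<Rightarrow> real) \<Rightarrow> ('a \<Rightarrow> 'a) \<Rightarrow> ('a \<Rightarrow> ('a \<Rightarrow>\<^sub>L 'a)) \<Rightarrow> 'a \<Rightarrow> 'a \<Rightarrow> real" where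
  "tr_ratio f g B x s =
     (f x - f (x + s)) / (tr_model f g B x 0 - tr_model f g B x s)"

definition tr_parameters ::
    "real \<Rightarrow> real \<Rightarrow> real \<Rightarrow> real \<Rightarrow> real \<Rightarrow> real \<Rightarrow> (nat \<Rightarrow> real) \<Rightarrow> bool" where
  "tr_parameters \<eta>1 \<eta>2 \<gamma>1 \<gamma>2 \<gamma>3 \<tau>bar \<tau> \<longleftrightarrow>
     0 < \<eta>1 \<and> \<eta>1 \<le> \<eta>2 \<and> \<eta>2 < 1 \<and>
     0 < \<gamma>1 \<and> \<gamma>1 \<le> \<gamma>2 \<and> \<gamma>2 < 1 \<and> 1 \<le> \<gamma>3 \<and>
     0 < \<tau>bar \<and> (\<forall>k. 0 \<le> \<tau> k \<and> \<tau> k < \<tau>bar)"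

text \<open>\<open>tr_run\<close> describes an infinite run with iterates \<open>x\<close>, steps \<open>s\<close> and radii \<open>\<Delta>\<close>; the steps
  and the radii are chosen nondeterministically, so they are related rather than computed.\<close>

definition tr_run ::
    "('a::euclidean_space \<Rightarrow> real) \<Rightarrow> ('a \<Rightarrow> 'a) \<Rightarrow> ('a \<Rightarrow> ('a \<Rightarrow>\<^sub>L 'a)) \<Rightarrow>
     real \<Rightarrow> real \<Rightarrow> real \<Rightarrow> real \<Rightarrow> real \<Rightarrow> (nat \<Rightarrow> real) \<Rightarrow>
     (nat \<Rightarrow> 'a) \<Rightarrow> (nat \<Rightarrow> 'a) \<Rightarrow> (nat \<Rightarrow> real) \<Rightarrow> bool" where
  "tr_run f g B \<eta>1 \<eta>2 \<gamma>1 \<gamma>2 \<gamma>3 \<tau> x s \<Delta> \<longleftrightarrow>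
     0 < \<Delta> 0 \<and>
     (\<forall>k. g (x k) \<noteq> 0) \<and>
     (\<forall>k. norm (s k) \<le> \<Delta> k) \<and>
     (\<forall>k s'. tr_solution f g B (x k) (\<Delta> k) s' \<longrightarrow>
        tr_model f g B (x k) 0 - tr_model f g B (x k) (s k)
          \<ge> 1 / (1 + \<tau> k) * (tr_model f g B (x k) 0 - tr_model f g B (x k) s')) \<and>
     (\<forall>k. x (Suc k) = (if tr_ratio f g B (x k) (s k) \<ge> \<eta>1 then x k + s k else x k)) \<and>
     (\<forall>k. \<Delta> (Suc k) \<in>
        (if tr_ratio f g B (x k) (s k) < \<eta>1 then {\<gamma>1 * \<Delta> k .. \<gamma>2 * \<Delta> k}
         else if tr_ratio f g B (x k) (s k) < \<eta>2 then {\<gamma>2 * \<Delta> k .. \<Delta> k}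
         else {\<Delta> k .. \<gamma>3 * \<Delta> k}))"

end

theory Submission
  imports Defs
begin

text \<open>Near \<open>xstar\<close> the Hessians are uniformly coercive, with constant \<open>\<mu>\<close>, and bounded by some
  \<open>M\<close>. Coercivity bounds every step that does not increase the model by \<open>2 / \<mu> * norm g\<close>. Together
  with the Cauchy decrease this makes the predicted decrease at least a fixed multiple of
  \<open>(norm s)\<^sup>2\<close>, whereas by Taylor's formula the model error is \<open>o((norm s)\<^sup>2)\<close>. So all
  late steps are very successful, the radii stop shrinking, and the constraint becomes
  inactive because the gradients vanish in the limit. The exact step is then the Newton
  step, and the computed step differs from it by
  \<open>O(sqrt \<tau> * norm g)\<close>, which is quadratically small in the error.\<close>

section \<open>Facts on the function and its Hessian\<close>

lemma line_derivative:
  assumes "C2_with_grad_hess f g B"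
  shows "((\<lambda>t. f (x + t *\<^sub>R u)) has_real_derivative g (x + t *\<^sub>R u) \<bullet> u) (at t)"
proof -
  have "(f has_derivative (\<lambda>h. h \<bullet> g (x + t *\<^sub>R u))) (at (x + t *\<^sub>R u))"
    using assms by (simp add: C2_with_grad_hess_def gderiv_def)
  moreover have "((\<lambda>t. x + t *\<^sub>R u) has_derivative (\<lambda>h. h *\<^sub>R u)) (at t)"
    by (auto intro!: derivative_eq_intros)
  ultimately have "((\<lambda>t. f (x + t *\<^sub>R u)) has_derivative (\<lambda>h. (h *\<^sub>R u) \<bullet> g (x + t *\<^sub>R u))) (at t)"
    by (rule has_derivative_compose[rotated])
  then show ?thesis
    by (simp add: has_field_derivative_def inner_commute mult_commute_abs)
qed

lemma gradient_line_derivative: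
  assumes "C2_with_grad_hess f g B"
  shows "((\<lambda>t. g (x + t *\<^sub>R u) \<bullet> v) has_real_derivative B (x + t *\<^sub>R u) u \<bullet> v) (at t)"
proof -
  have "(g has_derivative blinfun_apply (B (x + t *\<^sub>R u))) (at (x + t *\<^sub>R u))"
    using assms by (simp add: C2_with_grad_hess_def)
  moreover have "((\<lambda>t. x + t *\<^sub>R u) has_derivative (\<lambda>h. h *\<^sub>R u)) (at t)"
    by (auto intro!: derivative_eq_intros)
  ultimately have "((\<lambda>t. g (x + t *\<^sub>R u)) has_derivative (\<lambda>h. B (x + t *\<^sub>R u) (h *\<^sub>R u))) (at t)"
    by (rule has_derivative_compose[rotated])
  then have "((\<lambda>t. g (x + t *\<^sub>R u) \<bullet> v) has_derivative
      (\<lambda>h. B (x + t *\<^sub>R u) (h *\<^sub>R u) \<bullet> v)) (at t)"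
    by (rule has_derivative_inner_left)
  then show ?thesis
    by (simp add: has_field_derivative_def blinfun.scaleR_right mult_commute_abs)
qed

text \<open>Two mean value steps. The left-hand side is the increment over \<open>[0, t]\<close>
  along \<open>u\<close> of the difference of \<open>f\<close> between the lines through
  \<open>x + t *\<^sub>R v\<close> and \<open>x\<close>. Its derivative is an increment of
  \<open>g\<close> along \<open>v\<close>, to which the mean value theorem applies again.\<close>

lemma second_difference:
  assumes "C2_with_grad_hess f g B" and "t > 0"
  shows "\<exists>\<xi>\<in>{0<..<t}. \<exists>\<zeta>\<in>{0<..<t}.
    f (x + t *\<^sub>R u + t *\<^sub>R v) - f (x + t *\<^sub>R u) - f (x + t *\<^sub>R v) + f x
      = t\<^sup>2 * (B (x + \<xi> *\<^sub>R u + \<zeta> *\<^sub>R v) v \<bullet> u)"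
proof -
  let ?h = "\<lambda>r. f ((x + t *\<^sub>R v) + r *\<^sub>R u) - f (x + r *\<^sub>R u)"
  have "(?h has_real_derivative (g ((x + t *\<^sub>R v) + r *\<^sub>R u) \<bullet> u - g (x + r *\<^sub>R u) \<bullet> u)) (at r)" for r
    by (intro DERIV_diff line_derivative[OF assms(1)])
  from MVT2[OF assms(2) this]
  obtain \<xi> where \<xi>: "\<xi> > 0" "\<xi> < t"
      "?h t - ?h 0 = (t - 0) * (g ((x + t *\<^sub>R v) + \<xi> *\<^sub>R u) \<bullet> u - g (x + \<xi> *\<^sub>R u) \<bullet> u)"
    by blast
  let ?q = "\<lambda>r. g ((x + \<xi> *\<^sub>R u) + r *\<^sub>R v) \<bullet> u"
  from MVT2[OF assms(2) gradient_line_derivative[OF assms(1)]]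
  obtain \<zeta> where \<zeta>: "\<zeta> > 0" "\<zeta> < t"
      "?q t - ?q 0 = (t - 0) * (B ((x + \<xi> *\<^sub>R u) + \<zeta> *\<^sub>R v) v \<bullet> u)"
    by blast
  have "?h t - ?h 0 = t * (?q t - ?q 0)"
    using \<xi>(3) by (simp add: ac_simps)
  then have "?h t - ?h 0 = t\<^sup>2 * (B ((x + \<xi> *\<^sub>R u) + \<zeta> *\<^sub>R v) v \<bullet> u)"
    using \<zeta>(3) by (simp add: power2_eq_square)
  then have "f (x + t *\<^sub>R u + t *\<^sub>R v) - f (x + t *\<^sub>R u) - f (x + t *\<^sub>R v) + f x
      = t\<^sup>2 * (B (x + \<xi> *\<^sub>R u + \<zeta> *\<^sub>R v) v \<bullet> u)"
    by (simp add: algebra_simps)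
  then show ?thesis using \<xi>(1,2) \<zeta>(1,2) by (intro bexI[of _ \<xi>] bexI[of _ \<zeta>]) auto
qed

lemma hessian_continuity:
  assumes "C2_with_grad_hess f g B" and "\<epsilon> > 0"
  obtains \<delta> where "\<delta> > 0" "\<And>z. norm (z - y) < \<delta> \<Longrightarrow> norm (B z - B y) < \<epsilon>"
proof -
  have "\<exists>\<delta>>0. \<forall>z\<in>UNIV. dist z y < \<delta> \<longrightarrow> dist (B z) (B y) < \<epsilon>"
    using assms unfolding C2_with_grad_hess_def continuous_on_iff by blast
  then show thesis using that by (auto simp: dist_norm)
qed

text \<open>Both orders of the mixed second difference quotient are values of the Hessian near
  \<open>x\<close>, so continuity makes the two limits agree.\<close>

lemma hessian_symmetric:
  assumes "C2_with_grad_hess f g B"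
  shows "B x u \<bullet> v = B x v \<bullet> u"
proof (rule ccontr)
  assume "B x u \<bullet> v \<noteq> B x v \<bullet> u"
  define e where "e = \<bar>B x u \<bullet> v - B x v \<bullet> u\<bar>"
  have "e > 0" using \<open>B x u \<bullet> v \<noteq> B x v \<bullet> u\<close> by (simp add: e_def)
  \<comment> \<open>Replacing two Hessian values by \<open>B x\<close> costs at most
    \<open>2 * c * norm u * norm v\<close>, which this choice keeps below \<open>e\<close>. The
    added 1 keeps the denominator positive when \<open>u\<close> or \<open>v\<close>
    vanishes.\<close>
  define c where "c = e / (4 * (norm u * norm v + 1))"
  have nn: "norm u * norm v \<ge> 0" by simp
  have "c > 0" using \<open>e > 0\<close> nn by (simp add: c_def add_nonneg_pos)
  obtain \<delta> where \<delta>: "\<delta> > 0" "\<And>z. norm (z - x) < \<delta> \<Longrightarrow> norm (B z - B x) < c"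
    using hessian_continuity[OF assms \<open>c > 0\<close>] by metis
  define t where "t = \<delta> / (norm u + norm v + 1)"
  have "norm u + norm v + 1 > 0" by (simp add: add_nonneg_pos)
  then have "t > 0" "t * (norm u + norm v) < \<delta>"
    using \<delta>(1) by (simp_all add: t_def divide_simps algebra_simps)
  have near: "\<bar>B (x + w) a \<bullet> b - B x a \<bullet> b\<bar> \<le> c * (norm a * norm b)"
    if "norm w < \<delta>" for a b w
  proof -
    have "\<bar>(B (x + w) - B x) a \<bullet> b\<bar> \<le> norm (B (x + w) - B x) * norm a * norm b"
      by (meson Cauchy_Schwarz_ineq2 mult_right_mono norm_blinfun norm_ge_zero order_trans)
    also have "\<dots> \<le> c * norm a * norm b"
      using \<delta>(2)[of "x + w"] that by (intro mult_right_mono) auto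
    finally show ?thesis by (simp add: blinfun.diff_left inner_diff_left mult.assoc)
  qed
  have small: "norm (\<xi> *\<^sub>R u + \<zeta> *\<^sub>R v) < \<delta>" if "\<xi> \<in> {0<..<t}" "\<zeta> \<in> {0<..<t}" for \<xi> \<zeta>
  proof -
    have "norm (\<xi> *\<^sub>R u + \<zeta> *\<^sub>R v) \<le> \<xi> * norm u + \<zeta> * norm v"
      using norm_triangle_ineq[of "\<xi> *\<^sub>R u" "\<zeta> *\<^sub>R v"] that by simp
    also have "\<dots> \<le> t * norm u + t * norm v"
      using that by (intro add_mono mult_right_mono) auto
    finally show ?thesis using \<open>t * (norm u + norm v) < \<delta>\<close> by (simp add: algebra_simps)
  qed
  obtain \<xi> \<zeta> where 1: "\<xi> \<in> {0<..<t}" "\<zeta> \<in> {0<..<t}"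
    "f (x + t *\<^sub>R u + t *\<^sub>R v) - f (x + t *\<^sub>R u) - f (x + t *\<^sub>R v) + f x
      = t\<^sup>2 * (B (x + \<xi> *\<^sub>R u + \<zeta> *\<^sub>R v) v \<bullet> u)"
    using second_difference[OF assms \<open>t > 0\<close>] by blast
  obtain \<xi>' \<zeta>' where 2: "\<xi>' \<in> {0<..<t}" "\<zeta>' \<in> {0<..<t}"
    "f (x + t *\<^sub>R v + t *\<^sub>R u) - f (x + t *\<^sub>R v) - f (x + t *\<^sub>R u) + f x
      = t\<^sup>2 * (B (x + \<xi>' *\<^sub>R v + \<zeta>' *\<^sub>R u) u \<bullet> v)"
    using second_difference[OF assms \<open>t > 0\<close>] by blast
  \<comment> \<open>The second difference does not change when \<open>u\<close> and \<open>v\<close>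
    are exchanged.\<close>
  have "t\<^sup>2 * (B (x + (\<xi> *\<^sub>R u + \<zeta> *\<^sub>R v)) v \<bullet> u) = t\<^sup>2 * (B (x + (\<zeta>' *\<^sub>R u + \<xi>' *\<^sub>R v)) u \<bullet> v)"
    using 1(3) 2(3) by (simp add: algebra_simps)
  then have "B (x + (\<xi> *\<^sub>R u + \<zeta> *\<^sub>R v)) v \<bullet> u = B (x + (\<zeta>' *\<^sub>R u + \<xi>' *\<^sub>R v)) u \<bullet> v"
    using \<open>t > 0\<close> by simp
  then have "e \<le> 2 * (c * (norm u * norm v))"
    using near[OF small[OF 1(1,2)], of v u] near[OF small[OF 2(2,1)], of u v]
    by (simp add: e_def mult.commute)
  also have "\<dots> < e"
  proof -
    have "4 * (norm u * norm v + 1) * c = e"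
      using nn by (simp add: c_def add_nonneg_pos order_less_imp_not_eq2)
    then have "e = 2 * (c * (norm u * norm v)) + 2 * (c * (norm u * norm v)) + 4 * c"
      by (simp add: algebra_simps)
    moreover have "c * (norm u * norm v) \<ge> 0" using \<open>c > 0\<close> by simp
    ultimately show ?thesis using \<open>c > 0\<close> by linarith
  qed
  finally show False by simp
qed

lemma gradient_zero_at_local_minimizer:
  assumes "C2_with_grad_hess f g B" and "local_minimizer f z"
  shows "g z = 0"
proof -
  obtain S where "open S" "z \<in> S" "\<forall>y\<in>S. f z \<le> f y"
    using assms(2) by (auto simp: local_minimizer_def eventually_nhds)
  moreover have "(f has_derivative (\<lambda>h. h \<bullet> g z)) (at z)"
    using assms(1) by (simp add: C2_with_grad_hess_def gderiv_def)
  ultimately have "(\<lambda>h. h \<bullet> g z) = (\<lambda>h. 0)"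
    by (intro differential_zero_maxmin) auto
  then have "g z \<bullet> g z = 0" by metis
  then show ?thesis by simp
qed

text \<open>The unit sphere is compact, so the quadratic form attains a positive minimum there;
  homogeneity carries it to all vectors.\<close>

lemma pos_def_coercive:
  assumes "pos_def A"
  obtains \<mu> where "\<mu> > 0" "\<And>v. A v \<bullet> v \<ge> \<mu> * (norm v)\<^sup>2"
proof -
  have "continuous_on (sphere 0 1) (\<lambda>v. A v \<bullet> v)"
    by (intro continuous_intros)
  moreover have "sphere (0::'a) 1 \<noteq> {}"
    using SOME_Basis norm_Basis by (auto simp: sphere_def)
  ultimately obtain w where w: "w \<in> sphere 0 1" "\<And>v. v \<in> sphere 0 1 \<Longrightarrow> A w \<bullet> w \<le> A v \<bullet> v"
    using continuous_attains_inf[of "sphere 0 1" "\<lambda>v. A v \<bullet> v"] by auto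
  have "A w \<bullet> w > 0"
    using assms w(1) unfolding pos_def_def by (metis mem_sphere_0 norm_zero zero_neq_one)
  moreover have "A v \<bullet> v \<ge> (A w \<bullet> w) * (norm v)\<^sup>2" for v
  proof (cases "v = 0")
    case False
    have "A w \<bullet> w \<le> A (v /\<^sub>R norm v) \<bullet> (v /\<^sub>R norm v)"
      using False by (intro w(2)) simp
    also have "\<dots> = (A v \<bullet> v) / (norm v)\<^sup>2"
      by (simp add: blinfun.scaleR_right power2_eq_square divide_inverse)
    finally show ?thesis using False by (simp add: pos_le_divide_eq)
  qed simp
  ultimately show thesis using that by blast
qed

lemma quadratic_form_perturbation:
  fixes A A' :: "'a::euclidean_space \<Rightarrow>\<^sub>L 'a"
  assumes "norm (A - A') \<le> \<epsilon>"
  shows "\<bar>A v \<bullet> v - A' v \<bullet> v\<bar> \<le> \<epsilon> * (norm v)\<^sup>2"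
proof -
  have "\<bar>(A - A') v \<bullet> v\<bar> \<le> norm (A - A') * norm v * norm v"
    by (meson Cauchy_Schwarz_ineq2 mult_right_mono norm_blinfun norm_ge_zero order_trans)
  also have "\<dots> \<le> \<epsilon> * norm v * norm v"
    using assms by (intro mult_right_mono) auto
  finally show ?thesis
    by (simp add: blinfun.diff_left inner_diff_left power2_eq_square)
qed

text \<open>The model is the second-order Taylor polynomial of \<open>f\<close> at \<open>x\<close>.
  With the Lagrange remainder, the error is half the quadratic form of a Hessian difference along
  the segment.\<close>

lemma taylor_model_error:
  assumes "C2_with_grad_hess f g B" and "\<And>t. t \<in> {0..1} \<Longrightarrow> norm (B (x + t *\<^sub>R s) - B x) \<le> \<epsilon>"
  shows "\<bar>f (x + s) - tr_model f g B x s\<bar> \<le> \<epsilon> / 2 * (norm s)\<^sup>2"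
proof -
  \<comment> \<open>The derivatives of \<open>f\<close> along the segment, indexed by order; the
    expansion of order 2 reads only \<open>d 0\<close>, \<open>d 1\<close> and
    \<open>d 2\<close>.\<close>
  define d where "d m = (if m = 0 then (\<lambda>t. f (x + t *\<^sub>R s)) else if m = Suc 0 then (\<lambda>t. g (x + t *\<^sub>R s) \<bullet> s)
    else (\<lambda>t. B (x + t *\<^sub>R s) s \<bullet> s))" for m
  have "\<exists>t>0. t < 1 \<and> d 0 1 = (\<Sum>m<2. d m 0 / fact m * 1 ^ m) + d 2 t / fact 2 * 1 ^ 2"
  proof (rule Maclaurin)
    show "\<forall>m t. m < 2 \<and> 0 \<le> t \<and> t \<le> 1 \<longrightarrow> (d m has_real_derivative d (Suc m) t) (at t)"
      using line_derivative[OF assms(1)] gradient_line_derivative[OF assms(1)]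
      by (auto simp: d_def less_2_cases_iff)
  qed auto
  then obtain t where t: "t > 0" "t < 1"
    and eq: "d 0 1 = (\<Sum>m<2. d m 0 / fact m * 1 ^ m) + d 2 t / fact 2 * 1 ^ 2"
    by blast
  have "f (x + s) = f x + g x \<bullet> s + (B (x + t *\<^sub>R s) s \<bullet> s) / 2"
    using eq by (simp add: d_def numeral_2_eq_2)
  moreover have "\<bar>B (x + t *\<^sub>R s) s \<bullet> s - B x s \<bullet> s\<bar> \<le> \<epsilon> * (norm s)\<^sup>2"
    using t by (intro quadratic_form_perturbation assms(2)) auto
  ultimately show ?thesis
    by (simp add: tr_model_def abs_le_iff field_simps)
qed

text \<open>The mean value inequality for \<open>g - A\<close>. The operator \<open>A\<close> is
  left free: \<open>A = 0\<close> yields a Lipschitz bound for the gradient, and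
  \<open>A = B z\<close> the error of a Newton step at \<open>z\<close>.\<close>

lemma gradient_linearization:
  assumes "C2_with_grad_hess f g B" and "\<And>t. t \<in> {0..1} \<Longrightarrow> norm (B (y + t *\<^sub>R (z - y)) - A) \<le> \<epsilon>"
  shows "norm (g z - g y - A (z - y)) \<le> norm (z - y) * \<epsilon>"
proof -
  let ?h = "\<lambda>w. g w - A w"
  have "norm (?h z - ?h y) \<le> \<epsilon> * norm (z - y)"
  proof (rule differentiable_bound[where S = "closed_segment y z" and f' = "\<lambda>w. blinfun_apply (B w - A)"])
    fix w assume "w \<in> closed_segment y z"
    have "(g has_derivative blinfun_apply (B w)) (at w within closed_segment y z)"
      using assms(1) by (simp add: C2_with_grad_hess_def has_derivative_at_withinI)
    moreover have "(blinfun_apply A has_derivative blinfun_apply A) (at w within closed_segment y z)"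
      by (rule bounded_linear_imp_has_derivative[OF blinfun.bounded_linear_right])
    ultimately have "(?h has_derivative (\<lambda>v. B w v - A v)) (at w within closed_segment y z)"
      by (rule has_derivative_diff)
    then show "(?h has_derivative blinfun_apply (B w - A)) (at w within closed_segment y z)"
      by (simp add: blinfun.diff_left[abs_def] minus_blinfun.rep_eq)
    from \<open>w \<in> closed_segment y z\<close> obtain t where "t \<in> {0..1}" "w = y + t *\<^sub>R (z - y)"
      by (auto simp: closed_segment_def algebra_simps)
    then show "onorm (blinfun_apply (B w - A)) \<le> \<epsilon>"
      using assms(2) by (simp flip: norm_blinfun.rep_eq)
  qed auto
  then show ?thesis by (simp add: blinfun.diff_right algebra_simps)
qed

section \<open>The trust-region subproblem\<close>

lemma tr_solution_le:
  assumes "tr_solution f g B x \<Delta> s" and "norm t \<le> \<Delta>"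
  shows "tr_model f g B x s \<le> tr_model f g B x t"
  using assms by (auto simp: tr_solution_def is_arg_min_linorder)

text \<open>The solution is compared with a point on the ray of steepest descent. Along that ray the
  curvature is at most \<open>M\<close>, so half of the linear decrease survives.\<close>

lemma cauchy_decrease:
  assumes sol: "tr_solution f g B x \<Delta> s" and "\<Delta> \<ge> 0" and "M > 0" and "norm (B x) \<le> M" and "g x \<noteq> 0"
  shows "tr_model f g B x 0 - tr_model f g B x s \<ge> norm (g x) / 2 * min \<Delta> (norm (g x) / M)"
proof -
  let ?G = "norm (g x)"
  \<comment> \<open>The smaller of \<open>1 / M\<close>, the minimizer along the ray if the
    curvature were \<open>M\<close>, and \<open>\<Delta> / ?G\<close>, where the ray leaves the
    trust region.\<close>
  define \<alpha> where "\<alpha> = min \<Delta> (?G / M) / ?G"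
  have G: "?G > 0" using assms by simp
  have \<alpha>: "\<alpha> \<ge> 0" "\<alpha> * ?G \<le> \<Delta>" "\<alpha> * M \<le> 1"
  proof -
    show "\<alpha> \<ge> 0" "\<alpha> * ?G \<le> \<Delta>" using G assms by (simp_all add: \<alpha>_def)
    have "\<alpha> \<le> (?G / M) / ?G" unfolding \<alpha>_def using G by (intro divide_right_mono) auto
    then show "\<alpha> * M \<le> 1" using G assms(3) by (simp add: field_simps)
  qed
  have "B x (g x) \<bullet> g x \<le> norm (B x) * ?G * ?G"
    by (meson Cauchy_Schwarz_ineq2 abs_le_D1 mult_right_mono norm_blinfun norm_ge_zero order_trans)
  also have "\<dots> \<le> M * ?G * ?G"
    using assms by (intro mult_right_mono) auto
  finally have q: "B x (g x) \<bullet> g x \<le> M * ?G\<^sup>2" by (simp add: power2_eq_square)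
  have "norm (- \<alpha> *\<^sub>R g x) \<le> \<Delta>" using \<alpha> by simp
  then have "tr_model f g B x s \<le> tr_model f g B x (- \<alpha> *\<^sub>R g x)"
    by (rule tr_solution_le[OF sol])
  also have "\<dots> = f x - \<alpha> * ?G\<^sup>2 + \<alpha>\<^sup>2 * (B x (g x) \<bullet> g x) / 2"
    by (simp add: tr_model_def blinfun.scaleR_right blinfun.minus_right power2_norm_eq_inner power2_eq_square[of \<alpha>])
  also have "\<dots> \<le> f x - \<alpha> * ?G\<^sup>2 / 2"
  proof -
    have "\<alpha>\<^sup>2 * (B x (g x) \<bullet> g x) \<le> \<alpha>\<^sup>2 * (M * ?G\<^sup>2)"
      using q by (intro mult_left_mono) auto
    also have "\<dots> = (\<alpha> * M) * (\<alpha> * ?G\<^sup>2)" by (simp add: power2_eq_square)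
    also have "\<dots> \<le> 1 * (\<alpha> * ?G\<^sup>2)"
      using \<alpha> by (intro mult_right_mono) auto
    finally show ?thesis by simp
  qed
  finally show ?thesis
    using G by (simp add: tr_model_def \<alpha>_def power2_eq_square mult.commute)
qed

text \<open>If the model does not increase, the linear term, at most
  \<open>norm (g x) * norm s\<close> in size, has to pay for the coercive quadratic term.\<close>

lemma step_bound:
  fixes B :: "'a::euclidean_space \<Rightarrow> ('a \<Rightarrow>\<^sub>L 'a)"
  assumes coer: "B x s \<bullet> s \<ge> \<mu> * (norm s)\<^sup>2" and "\<mu> > 0"
    and le: "tr_model f g B x s \<le> tr_model f g B x 0"
  shows "norm s \<le> 2 / \<mu> * norm (g x)"
proof (cases "s = 0")
  case False
  have "\<mu> * (norm s)\<^sup>2 \<le> 2 * (- (g x \<bullet> s))"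
    using le coer by (simp add: tr_model_def)
  also have "\<dots> \<le> 2 * (norm (g x) * norm s)"
    using Cauchy_Schwarz_ineq2[of "g x" s] by linarith
  finally have "(\<mu> * norm s) * norm s \<le> (2 * norm (g x)) * norm s"
    by (simp add: power2_eq_square)
  then have "\<mu> * norm s \<le> 2 * norm (g x)" using False by simp
  then show ?thesis using assms(2) by (simp add: field_simps)
qed (use assms in simp)

lemma interior_solution_stationary:
  fixes B :: "'a::euclidean_space \<Rightarrow> ('a \<Rightarrow>\<^sub>L 'a)"
  assumes sol: "tr_solution f g B x \<Delta> s" and int: "norm s < \<Delta>"
    and sym: "\<And>u v. B x u \<bullet> v = B x v \<bullet> u"
  shows "B x s = - g x"
proof -
  have "(tr_model f g B x has_derivative (\<lambda>h. g x \<bullet> h + 1/2 * (B x s \<bullet> h + B x h \<bullet> s))) (at s)"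
    unfolding tr_model_def[abs_def] by (auto intro!: derivative_eq_intros)
  moreover have "\<forall>t\<in>ball 0 \<Delta>. tr_model f g B x s \<le> tr_model f g B x t"
    using tr_solution_le[OF sol] by auto
  ultimately have "(\<lambda>h. g x \<bullet> h + 1/2 * (B x s \<bullet> h + B x h \<bullet> s)) = (\<lambda>h. 0)"
    using int by (intro differential_zero_maxmin[of s "ball 0 \<Delta>"]) auto
  then have "g x \<bullet> h + 1/2 * (B x s \<bullet> h + B x h \<bullet> s) = 0" for h by metis
  \<comment> \<open>By symmetry the gradient of the model at \<open>s\<close> is
    \<open>g x + B x s\<close>; the vanishing derivative is tested in this very direction.\<close>
  from this[of "g x + B x s"] have "(g x + B x s) \<bullet> (g x + B x s) = 0"
    using sym[of "g x + B x s" s] by (simp only: inner_add_left) simp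
  then have "g x + B x s = 0" by (simp only: inner_eq_zero_iff)
  then show ?thesis by (simp add: eq_neg_iff_add_eq_0 add.commute)
qed

text \<open>A quadratic expanded about its stationary point has no linear term. This converts gaps
  in model value into distances between steps.\<close>

lemma tr_model_at_stationary_point:
  fixes B :: "'a::euclidean_space \<Rightarrow> ('a \<Rightarrow>\<^sub>L 'a)"
  assumes "B x s = - g x" and sym: "\<And>u v. B x u \<bullet> v = B x v \<bullet> u"
  shows "tr_model f g B x t - tr_model f g B x s = 1/2 * (B x (t - s) \<bullet> (t - s))"
proof -
  have "g x = - B x s" using assms(1) by simp
  then show ?thesis
    using sym[of t s]
    by (simp add: tr_model_def blinfun.diff_right inner_diff_left inner_diff_right algebra_simps)
qed

text \<open>Coercivity gives a trivial kernel, and finite dimension gives surjectivity. Hence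
  \<open>inv\<close> in the Newton formula is a genuine inverse.\<close>

lemma coercive_bij:
  fixes A :: "'a::euclidean_space \<Rightarrow>\<^sub>L 'a"
  assumes "\<And>v. A v \<bullet> v \<ge> \<mu> * (norm v)\<^sup>2" and "\<mu> > 0"
  shows "bij A"
proof -
  have lin: "linear A" by (simp add: blinfun.bounded_linear_right bounded_linear.linear)
  have "inj A"
  proof (rule linear_injective_0[OF lin, THEN iffD2], intro allI impI)
    fix v assume "A v = 0"
    then show "v = 0" using assms(1)[of v] assms(2) by (simp add: mult_le_0_iff)
  qed
  then show ?thesis
    using linear_injective_imp_surjective[OF lin] by (simp add: bij_def)
qed

lemma coercive_norm_le:
  fixes A :: "'a::euclidean_space \<Rightarrow>\<^sub>L 'a"
  assumes "A v \<bullet> v \<ge> \<mu> * (norm v)\<^sup>2"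
  shows "\<mu> * norm v \<le> norm (A v)"
proof (cases "v = 0")
  case False
  have "(\<mu> * norm v) * norm v \<le> norm (A v) * norm v"
    using assms norm_cauchy_schwarz[of "A v" v] by (simp add: power2_eq_square)
  then show ?thesis using False by simp
qed simp

text \<open>Both arguments of the minimum in the Cauchy decrease are bounded below by multiples of
  \<open>norm s\<close>.\<close>

lemma inexact_decrease:
  assumes dec: "tr_model f g B x 0 - tr_model f g B x s \<ge>
      1 / (1 + \<tau>) * (tr_model f g B x 0 - tr_model f g B x s')"
    and sol: "tr_solution f g B x \<Delta> s'" and "norm s \<le> \<Delta>" and "\<Delta> > 0" and "g x \<noteq> 0"
    and M: "M > 0" "norm (B x) \<le> M"
    and coer: "B x s \<bullet> s \<ge> \<mu> * (norm s)\<^sup>2" and "\<mu> > 0"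
    and \<tau>: "0 \<le> \<tau>" "\<tau> \<le> \<tau>bar"
  shows "tr_model f g B x 0 - tr_model f g B x s > 0" (is ?pos)
    and "norm s \<le> 2 / \<mu> * norm (g x)" (is ?short)
    and "tr_model f g B x 0 - tr_model f g B x s \<ge>
      \<mu> * min 1 (\<mu> / (2 * M)) / (4 * (1 + \<tau>bar)) * (norm s)\<^sup>2" (is ?quad)
proof -
  let ?D = "tr_model f g B x 0 - tr_model f g B x s"
  let ?m = "min \<Delta> (norm (g x) / M)"
  let ?n = "min 1 (\<mu> / (2 * M))"
  have G: "norm (g x) > 0" using assms by simp
  have "norm (g x) / 2 * ?m \<le> tr_model f g B x 0 - tr_model f g B x s'"
    by (rule cauchy_decrease[OF sol]) (use assms in auto)
  then have "1 / (1 + \<tau>) * (norm (g x) / 2 * ?m) \<le> ?D"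
    using dec \<tau> by (meson mult_left_mono order_trans zero_le_divide_1_iff add_nonneg_nonneg zero_le_one)
  \<comment> \<open>Passing to the common bound \<open>\<tau>bar\<close> makes the constant the same
    for all iterations.\<close>
  moreover have "1 / (1 + \<tau>bar) \<le> 1 / (1 + \<tau>)"
    using \<tau> by (intro divide_left_mono) auto
  moreover have m: "?m > 0" using G assms by simp
  ultimately have D: "1 / (1 + \<tau>bar) * (norm (g x) / 2 * ?m) \<le> ?D"
    using G by (meson mult_right_mono order_trans less_imp_le mult_pos_pos half_gt_zero)
  moreover have "1 / (1 + \<tau>bar) * (norm (g x) / 2 * ?m) > 0"
    using G m \<tau> by (intro mult_pos_pos) auto
  ultimately show ?pos by linarith
  then have "tr_model f g B x s \<le> tr_model f g B x 0" by simp
  from step_bound[OF coer \<open>\<mu> > 0\<close> this] show s: ?short .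
  then have gs: "\<mu> * norm s / 2 \<le> norm (g x)" using \<open>\<mu> > 0\<close> by (simp add: field_simps)
  have "?n * norm s \<le> ?m"
  proof (rule min.boundedI)
    have "?n * norm s \<le> 1 * norm s" by (intro mult_right_mono) auto
    then show "?n * norm s \<le> \<Delta>" using assms(3) by simp
    have "?n * norm s \<le> \<mu> / (2 * M) * norm s" by (intro mult_right_mono) auto
    also have "\<dots> = (\<mu> * norm s / 2) / M" by simp
    also have "\<dots> \<le> norm (g x) / M" using gs M by (intro divide_right_mono) auto
    finally show "?n * norm s \<le> norm (g x) / M" .
  qed
  then have "(\<mu> * norm s / 2) / 2 * (?n * norm s) \<le> norm (g x) / 2 * ?m"
    using gs \<open>\<mu> > 0\<close> M by (intro mult_mono divide_right_mono) auto
  then have "1 / (1 + \<tau>bar) * ((\<mu> * norm s / 2) / 2 * (?n * norm s)) \<le> 1 / (1 + \<tau>bar) * (norm (g x) / 2 * ?m)"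
    using \<tau> by (intro mult_left_mono) auto
  also note D
  also have "1 / (1 + \<tau>bar) * ((\<mu> * norm s / 2) / 2 * (?n * norm s))
      = \<mu> * ?n / (4 * (1 + \<tau>bar)) * (norm s)\<^sup>2"
    by (simp add: power2_eq_square mult.commute mult.left_commute)
  finally show ?quad .
qed

text \<open>Inexactness loses at most \<open>\<tau>\<close> times the optimal decrease, which is at
  most \<open>(norm (g x))\<^sup>2 / (2 * \<mu>)\<close>. About the Newton step \<open>s'\<close>
  this loss is half the quadratic form at \<open>s - s'\<close>, so coercivity bounds the squared
  deviation by a fourth power of the gradient norm.\<close>

lemma inexact_step_deviation:
  assumes dec: "tr_model f g B x 0 - tr_model f g B x s \<ge>
      1 / (1 + \<tau>) * (tr_model f g B x 0 - tr_model f g B x s')"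
    and stat: "B x s' = - g x" and sym: "\<And>u v. B x u \<bullet> v = B x v \<bullet> u"
    and coer: "\<And>v. B x v \<bullet> v \<ge> \<mu> * (norm v)\<^sup>2" and "\<mu> > 0"
    and \<tau>: "0 \<le> \<tau>" "\<tau> \<le> (norm (g x))\<^sup>2"
  shows "norm (s - s') \<le> (norm (g x))\<^sup>2 / \<mu>"
proof -
  let ?D = "tr_model f g B x 0 - tr_model f g B x s'"
  let ?G = "norm (g x)"
  have "\<mu> * norm s' \<le> ?G" using coercive_norm_le[OF coer[of s']] stat by simp
  then have s': "norm s' \<le> ?G / \<mu>" using \<open>\<mu> > 0\<close> by (simp add: field_simps)
  have D: "?D = 1/2 * (B x s' \<bullet> s')"
    using tr_model_at_stationary_point[of B x s' g, OF stat sym, where t = 0 and f = f] by (simp add: blinfun.minus_right)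
  then have "?D \<ge> 0" using coer[of s'] \<open>\<mu> > 0\<close> by (smt (verit) mult_nonneg_nonneg zero_le_power2 zero_le_divide_iff)
  have "B x s' \<bullet> s' \<le> ?G * norm s'"
    using stat norm_cauchy_schwarz[of "B x s'" s'] by simp
  also have "\<dots> \<le> ?G * (?G / \<mu>)" using s' by (intro mult_left_mono) auto
  finally have D': "?D \<le> ?G\<^sup>2 / (2 * \<mu>)" unfolding D by (simp add: power2_eq_square)
  have "tr_model f g B x s - tr_model f g B x s' \<le> (1 - 1 / (1 + \<tau>)) * ?D"
    using dec by (simp add: algebra_simps)
  also have "\<dots> \<le> \<tau> * ?D"
  proof (rule mult_right_mono)
    have "1 - 1 / (1 + \<tau>) = \<tau> / (1 + \<tau>)" using \<tau> by (simp add: field_simps)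
    moreover have "\<tau> / (1 + \<tau>) \<le> \<tau>" using \<tau> by (simp add: divide_le_eq algebra_simps)
    ultimately show "1 - 1 / (1 + \<tau>) \<le> \<tau>" by simp
  qed fact
  also have "\<dots> \<le> ?G\<^sup>2 * (?G\<^sup>2 / (2 * \<mu>))"
    using \<tau> D' \<open>?D \<ge> 0\<close> by (intro mult_mono) auto
  finally have "1/2 * (B x (s - s') \<bullet> (s - s')) \<le> ?G\<^sup>2 * (?G\<^sup>2 / (2 * \<mu>))"
    using tr_model_at_stationary_point[of B x s' g, OF stat sym, where t = s and f = f] by simp
  with coer[of "s - s'"] have "\<mu> * (norm (s - s'))\<^sup>2 \<le> ?G\<^sup>2 * (?G\<^sup>2 / \<mu>)" by simp
  then have "(norm (s - s'))\<^sup>2 \<le> (?G\<^sup>2 / \<mu>)\<^sup>2"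
    using \<open>\<mu> > 0\<close> by (simp add: field_simps power2_eq_square)
  then show ?thesis by (rule power2_le_imp_le) (use \<open>\<mu> > 0\<close> in simp)
qed

text \<open>Since \<open>g y = 0\<close> and \<open>B x s' = - g x\<close>, applying
  \<open>B x\<close> to the new error gives, up to sign, the linearization error of \<open>g\<close>
  between \<open>y\<close> and \<open>x\<close>; coercivity then removes \<open>B x\<close>.\<close>

lemma newton_step_error:
  assumes C2: "C2_with_grad_hess f g B" and "g y = 0" and stat: "B x s' = - g x"
    and coer: "\<And>v. B x v \<bullet> v \<ge> \<mu> * (norm v)\<^sup>2"
    and near: "\<And>t. t \<in> {0..1} \<Longrightarrow> norm (B (y + t *\<^sub>R (x - y)) - B x) \<le> \<epsilon>"
  shows "\<mu> * norm (x + s' - y) \<le> norm (x - y) * \<epsilon>"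
proof -
  have "\<mu> * norm (x + s' - y) \<le> norm (B x (x + s' - y))"
    by (rule coercive_norm_le[OF coer])
  also have "B x (x + s' - y) = - (g x - g y - B x (x - y))"
    using stat assms(2) by (simp add: blinfun.add_right blinfun.diff_right)
  also have "norm \<dots> \<le> norm (x - y) * \<epsilon>"
    using gradient_linearization[OF C2 near] by (simp only: norm_minus_cancel)
  finally show ?thesis .
qed

theorem theorem14:
  fixes f :: "'a::euclidean_space \<Rightarrow> real"
    and g :: "'a \<Rightarrow> 'a"
    and B :: "'a \<Rightarrow> ('a \<Rightarrow>\<^sub>L 'a)"
    and x s :: "nat \<Rightarrow> 'a"
    and \<Delta> \<tau> :: "nat \<Rightarrow> real"
    and xstar :: 'a
    and L \<nu> \<eta>1 \<eta>2 \<gamma>1 \<gamma>2 \<gamma>3 \<tau>bar :: real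
  assumes C2: "C2_with_grad_hess f g B"
    and bounded_below: "bdd_below (range f)"
    and minimizer_exists: "\<exists>z. \<forall>y. f z \<le> f y"
    and L_pos: "L > 0"
    and nu: "\<nu> \<in> {0..1}"
    and hoelder: "hoelder_with L \<nu> B"
    and parameters: "tr_parameters \<eta>1 \<eta>2 \<gamma>1 \<gamma>2 \<gamma>3 \<tau>bar \<tau>"
    and run: "tr_run f g B \<eta>1 \<eta>2 \<gamma>1 \<gamma>2 \<gamma>3 \<tau> x s \<Delta>"
    and not_minimal: "\<And>k. f (x k) - (INF y. f y) > 0"
    and local_min: "local_minimizer f xstar"
    and hess_pos_def: "pos_def (B xstar)"
    and convergence: "x \<longlonglongrightarrow> xstar"
  shows "\<exists>(K0::nat) (\<Delta>low::real). \<Delta>low > 0 \<and>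
     (\<forall>k\<ge>K0. tr_ratio f g B (x k) (s k) \<ge> \<eta>2) \<and>
     (\<forall>k\<ge>K0. \<Delta> k \<ge> \<Delta>low) \<and>
     (\<forall>k\<ge>K0. bij (blinfun_apply (B (x k))) \<and>
        (\<forall>sstar. tr_solution f g B (x k) (\<Delta> k) sstar \<longrightarrow>
           sstar = - inv (blinfun_apply (B (x k))) (g (x k)) \<and>
           max (norm (s k)) (norm sstar) < \<Delta> k)) \<and>
     (\<nu> = 0 \<and> (\<forall>k. \<tau> k \<le> (norm (g (x k)))\<^sup>2) \<longrightarrow>
        (\<lambda>k. norm (x (Suc k) - xstar)) \<in> o(\<lambda>k. norm (x k - xstar))) \<and>
     (\<nu> \<in> {0<..1} \<and> (\<forall>k. \<tau> k \<le> (norm (g (x k)))\<^sup>2) \<longrightarrow>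
        (\<exists>C>0. \<forall>\<^sub>F k in sequentially.
           norm (x (Suc k) - xstar) \<le> C * norm (x k - xstar) powr (1 + \<nu>)))"
proof -

  \<comment> \<open>Basic properties of the run and of the limit point\<close>
  have \<eta>2: "\<eta>2 < 1" "\<eta>1 \<le> \<eta>2"
    and \<gamma>1: "\<gamma>1 > 0" and \<gamma>2: "\<gamma>2 > 0"
    and \<tau>bar: "\<tau>bar > 0" and \<tau>: "\<And>k. 0 \<le> \<tau> k" "\<And>k. \<tau> k \<le> \<tau>bar"
    using parameters by (auto simp: tr_parameters_def less_imp_le)
  have \<Delta>0: "\<Delta> 0 > 0" and g_nz: "\<And>k. g (x k) \<noteq> 0" and feas: "\<And>k. norm (s k) \<le> \<Delta> k"
    and dec: "\<And>k s'. tr_solution f g B (x k) (\<Delta> k) s' \<Longrightarrow>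
        tr_model f g B (x k) 0 - tr_model f g B (x k) (s k)
          \<ge> 1 / (1 + \<tau> k) * (tr_model f g B (x k) 0 - tr_model f g B (x k) s')"
    and x_Suc: "\<And>k. x (Suc k) = (if tr_ratio f g B (x k) (s k) \<ge> \<eta>1 then x k + s k else x k)"
    and \<Delta>_Suc: "\<And>k. \<Delta> (Suc k) \<in>
        (if tr_ratio f g B (x k) (s k) < \<eta>1 then {\<gamma>1 * \<Delta> k .. \<gamma>2 * \<Delta> k}
         else if tr_ratio f g B (x k) (s k) < \<eta>2 then {\<gamma>2 * \<Delta> k .. \<Delta> k}
         else {\<Delta> k .. \<gamma>3 * \<Delta> k})"
    using run unfolding tr_run_def by blast+
  have \<Delta>: "\<Delta> k > 0" for k
  proof (induction k)
    case (Suc k)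
    have "\<gamma>1 * \<Delta> k > 0" "\<gamma>2 * \<Delta> k > 0" using Suc \<gamma>1 \<gamma>2 by simp_all
    then show ?case using \<Delta>_Suc[of k] Suc by (auto split: if_splits)
  qed (rule \<Delta>0)
  have sym: "B z u \<bullet> v = B z v \<bullet> u" for z u v by (rule hessian_symmetric[OF C2])
  have g0: "g xstar = 0" by (rule gradient_zero_at_local_minimizer[OF C2 local_min])

  \<comment> \<open>Uniform bounds on the Hessian near the limit, and vanishing gradients\<close>
  obtain \<mu>0 where \<mu>0: "\<mu>0 > 0" "\<And>v. B xstar v \<bullet> v \<ge> \<mu>0 * (norm v)\<^sup>2"
    using pos_def_coercive[OF hess_pos_def] by blast
  \<comment> \<open>Half of the coercivity at \<open>xstar\<close> is kept and the other half
    absorbs the variation of the Hessian. The \<open>+ 1\<close> in \<open>M\<close> does the same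
    for the norm, hence the tolerance \<open>min \<mu> 1\<close> below.\<close>
  define \<mu> where "\<mu> = \<mu>0 / 2"
  define M where "M = norm (B xstar) + 1"
  have \<mu>: "\<mu> > 0" and M: "M > 0" using \<mu>0 by (simp_all add: \<mu>_def M_def add_nonneg_pos)
  obtain \<delta>1 where \<delta>1: "\<delta>1 > 0" "\<And>z. norm (z - xstar) < \<delta>1 \<Longrightarrow> norm (B z - B xstar) < min \<mu> 1"
    using hessian_continuity[OF C2, of "min \<mu> 1"] \<mu> by (metis min_less_iff_conj zero_less_one)
  have coer: "B z v \<bullet> v \<ge> \<mu> * (norm v)\<^sup>2" if "norm (z - xstar) < \<delta>1" for z v
  proof -
    have "\<bar>B z v \<bullet> v - B xstar v \<bullet> v\<bar> \<le> \<mu> * (norm v)\<^sup>2"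
      using \<delta>1(2)[OF that] by (intro quadratic_form_perturbation) auto
    moreover have "\<mu>0 * (norm v)\<^sup>2 = \<mu> * (norm v)\<^sup>2 + \<mu> * (norm v)\<^sup>2" by (simp add: \<mu>_def)
    ultimately show ?thesis using \<mu>0(2)[of v] by linarith
  qed
  have B_le: "norm (B z) \<le> M" if "norm (z - xstar) < \<delta>1" for z
    using \<delta>1(2)[OF that] norm_triangle_ineq2[of "B z" "B xstar"] by (simp add: M_def)

  have x_near: "\<forall>\<^sub>F k in sequentially. norm (x k - xstar) < \<delta>" if "\<delta> > 0" for \<delta>
    using tendstoD[OF convergence that] by (simp add: dist_norm)
  have "isCont g xstar"
    using C2 by (auto simp: C2_with_grad_hess_def intro: has_derivative_continuous)
  then have g_lim: "(\<lambda>k. g (x k)) \<longlonglongrightarrow> 0"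
    using isCont_tendsto_compose[OF _ convergence] g0 by metis
  \<comment> \<open>This multiple of the gradient norm is the bound on the step length from
    \<open>step_bound\<close>.\<close>
  have g_small: "\<forall>\<^sub>F k in sequentially. 2 / \<mu> * norm (g (x k)) < \<delta>" if "\<delta> > 0" for \<delta>
    using tendstoD[OF g_lim, of "\<delta> * \<mu> / 2"] that \<mu> by (simp add: field_simps)

  \<comment> \<open>Predicted decrease and very successful steps\<close>
  define c where "c = \<mu> * min 1 (\<mu> / (2 * M)) / (4 * (1 + \<tau>bar))"
  have c: "c > 0" using \<mu> M \<tau>bar by (simp add: c_def)
  have local_decrease: "tr_model f g B (x k) 0 - tr_model f g B (x k) (s k) > 0"
      "norm (s k) \<le> 2 / \<mu> * norm (g (x k))"
      "tr_model f g B (x k) 0 - tr_model f g B (x k) (s k) \<ge> c * (norm (s k))\<^sup>2"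
    if k: "norm (x k - xstar) < \<delta>1" for k
  proof -
    obtain s' where s': "tr_solution f g B (x k) (\<Delta> k) s'"
      using tr_solution_exists \<Delta> less_imp_le by metis
    note * = inexact_decrease[OF dec[OF s'] s' feas \<Delta> g_nz M B_le[OF k] coer[OF k] \<mu> \<tau>]
    from * show "tr_model f g B (x k) 0 - tr_model f g B (x k) (s k) > 0"
      "norm (s k) \<le> 2 / \<mu> * norm (g (x k))"
      "tr_model f g B (x k) 0 - tr_model f g B (x k) (s k) \<ge> c * (norm (s k))\<^sup>2"
      unfolding c_def by blast+
  qed

  \<comment> \<open>With this tolerance a model error of
    \<open>\<epsilon> * (norm (s k))\<^sup>2\<close> is at most the fraction
    \<open>1 - \<eta>2\<close> of the predicted decrease.\<close>
  define \<epsilon> where "\<epsilon> = (1 - \<eta>2) * c"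
  have \<epsilon>: "\<epsilon> > 0" using \<eta>2 c by (simp add: \<epsilon>_def)
  obtain \<delta>2 where \<delta>2: "\<delta>2 > 0" "\<And>z. norm (z - xstar) < \<delta>2 \<Longrightarrow> norm (B z - B xstar) < \<epsilon> / 2"
    using hessian_continuity[OF C2, of "\<epsilon> / 2"] \<epsilon> by (metis half_gt_zero)
  have successful: "tr_ratio f g B (x k) (s k) \<ge> \<eta>2"
    if k1: "norm (x k - xstar) < \<delta>1" and k2: "norm (x k - xstar) < \<delta>2 / 2"
      and k3: "2 / \<mu> * norm (g (x k)) < \<delta>2 / 2" for k
  proof -
    let ?D = "tr_model f g B (x k) 0 - tr_model f g B (x k) (s k)"
    have D: "?D > 0" "norm (s k) < \<delta>2 / 2" "c * (norm (s k))\<^sup>2 \<le> ?D"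
      using local_decrease[OF k1] k3 by auto
    \<comment> \<open>The iterate is within \<open>\<delta>2 / 2\<close> of \<open>xstar\<close> and
      the step is shorter than \<open>\<delta>2 / 2\<close>, so both Hessians are within
      \<open>\<epsilon> / 2\<close> of \<open>B xstar\<close>.\<close>
    have "norm (B (x k + t *\<^sub>R s k) - B (x k)) \<le> \<epsilon>" if "t \<in> {0..1}" for t
    proof -
      have "norm (t *\<^sub>R s k) \<le> norm (s k)" using that by (simp add: mult_left_le_one_le)
      then have "norm (x k + t *\<^sub>R s k - xstar) < \<delta>2"
        using norm_triangle_ineq[of "x k - xstar" "t *\<^sub>R s k"] D(2) k2 by (simp add: algebra_simps)
      from \<delta>2(2)[OF this] \<delta>2(2)[of "x k"] k2 \<delta>2(1) show ?thesis
        using norm_triangle_ineq4[of "B (x k + t *\<^sub>R s k) - B xstar" "B (x k) - B xstar"] by simp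
    qed
    from taylor_model_error[OF C2 this]
    have "\<bar>f (x k + s k) - tr_model f g B (x k) (s k)\<bar> \<le> \<epsilon> / 2 * (norm (s k))\<^sup>2" .
    also have "\<dots> \<le> \<epsilon> * (norm (s k))\<^sup>2"
      using \<epsilon> by (intro mult_right_mono) auto
    also have "\<dots> = (1 - \<eta>2) * (c * (norm (s k))\<^sup>2)"
      by (simp add: \<epsilon>_def)
    also have "\<dots> \<le> (1 - \<eta>2) * ?D" using D \<eta>2 by (intro mult_left_mono) auto
    \<comment> \<open>The model agrees with \<open>f\<close> at the zero step, so actual and
      predicted decrease differ exactly by the model error at \<open>s k\<close>.\<close>
    finally have "\<eta>2 * ?D \<le> f (x k) - f (x k + s k)"
      by (simp add: left_diff_distrib tr_model_def[of f g B "x k" 0] abs_le_iff)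
    then show ?thesis using D(1) by (simp add: tr_ratio_def pos_le_divide_eq)
  qed
  have "\<forall>\<^sub>F k in sequentially. norm (x k - xstar) < \<delta>1 \<and> tr_ratio f g B (x k) (s k) \<ge> \<eta>2"
    using x_near[OF \<delta>1(1)] x_near[OF half_gt_zero[OF \<delta>2(1)]] g_small[OF half_gt_zero[OF \<delta>2(1)]]
    by eventually_elim (simp add: successful)
  then obtain K1 where K1: "\<And>k. k \<ge> K1 \<Longrightarrow> norm (x k - xstar) < \<delta>1"
      "\<And>k. k \<ge> K1 \<Longrightarrow> tr_ratio f g B (x k) (s k) \<ge> \<eta>2"
    by (auto simp: eventually_sequentially)
  \<comment> \<open>After a very successful step the radius never shrinks, so
    \<open>\<Delta> K1\<close> is a lower bound from then on.\<close>
  have \<Delta>_ge: "\<Delta> k \<ge> \<Delta> K1" if "k \<ge> K1" for k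
    using that
  proof (induction k rule: dec_induct)
    case (step k)
    then show ?case using \<Delta>_Suc[of k] K1(2)[of k] \<eta>2 by auto
  qed simp
  obtain K where K: "\<And>k. k \<ge> K \<Longrightarrow> 2 / \<mu> * norm (g (x k)) < \<Delta> K1"
    using g_small[OF \<Delta>] by (auto simp: eventually_sequentially)
  define K0 where "K0 = max K K1"

  \<comment> \<open>Inactive constraint and Newton steps\<close>
  have newton: "norm (s k) < \<Delta> k" "norm s' < \<Delta> k" "B (x k) s' = - g (x k)"
    if "k \<ge> K0" and s': "tr_solution f g B (x k) (\<Delta> k) s'" for k s'
  proof -
    have k: "k \<ge> K1" "k \<ge> K" using that by (simp_all add: K0_def)
    have "tr_model f g B (x k) s' \<le> tr_model f g B (x k) 0"
      using tr_solution_le[OF s'] \<Delta>[of k] by simp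
    from step_bound[OF coer[OF K1(1)[OF k(1)]] \<mu> this] local_decrease(2)[OF K1(1)[OF k(1)]]
    show "norm (s k) < \<Delta> k" and *: "norm s' < \<Delta> k"
      using K[OF k(2)] \<Delta>_ge[OF k(1)] by linarith+
    show "B (x k) s' = - g (x k)"
      by (rule interior_solution_stationary[OF s' * sym])
  qed
  have bij: "bij (B (x k))" if "k \<ge> K0" for k
    by (rule coercive_bij[OF coer[OF K1(1)] \<mu>]) (use that in \<open>simp add: K0_def\<close>)
  have newton_inv: "s' = - inv (B (x k)) (g (x k))"
    if "k \<ge> K0" and s': "tr_solution f g B (x k) (\<Delta> k) s'" for k s'
  proof -
    have "B (x k) (- s') = g (x k)" using newton(3)[OF that] by (simp add: blinfun.minus_right)
    then have "inv (B (x k)) (g (x k)) = - s'"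
      using bij[OF that(1)] by (metis bij_is_inj inv_f_f)
    then show ?thesis by simp
  qed

  \<comment> \<open>Error after one step\<close>
  have error_step: "norm (x (Suc k) - xstar)
      \<le> norm (x k - xstar) * (\<epsilon>' / \<mu> + M\<^sup>2 / \<mu> * norm (x k - xstar))"
    if k: "k \<ge> K0" and \<tau>k: "\<tau> k \<le> (norm (g (x k)))\<^sup>2"
      and near: "\<And>t. t \<in> {0..1} \<Longrightarrow> norm (B (xstar + t *\<^sub>R (x k - xstar)) - B (x k)) \<le> \<epsilon>'" for k \<epsilon>'
  proof -
    have k1: "norm (x k - xstar) < \<delta>1" using K1(1) k by (simp add: K0_def)
    have Suc: "x (Suc k) = x k + s k" using x_Suc[of k] K1(2)[of k] \<eta>2 k by (simp add: K0_def)
    obtain s' where s': "tr_solution f g B (x k) (\<Delta> k) s'"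
      using tr_solution_exists \<Delta> less_imp_le by metis
    note stat = newton(3)[OF k s']
    have "norm (xstar + t *\<^sub>R (x k - xstar) - xstar) < \<delta>1" if "t \<in> {0..1}" for t
    proof -
      have "t * norm (x k - xstar) \<le> norm (x k - xstar)" using that by (simp add: mult_left_le_one_le)
      then show ?thesis using k1 that by simp
    qed
    \<comment> \<open>Linearization with the zero operator: the gradient vanishes at
      \<open>xstar\<close> and its derivative is bounded by \<open>M\<close> on the segment.\<close>
    from B_le[OF this] have "norm (g (x k)) \<le> norm (x k - xstar) * M"
      using gradient_linearization[OF C2, of xstar "x k" 0 M] g0 by simp
    then have "(norm (g (x k)))\<^sup>2 \<le> (norm (x k - xstar) * M)\<^sup>2" by (rule power_mono) simp
    then have "norm (s k - s') \<le> (norm (x k - xstar) * M)\<^sup>2 / \<mu>"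
      using inexact_step_deviation[OF dec[OF s'] stat sym coer[OF k1] \<mu> \<tau>(1) \<tau>k] \<mu>
      by (meson divide_right_mono less_imp_le order_trans)
    moreover have "norm (x k + s' - xstar) \<le> norm (x k - xstar) * \<epsilon>' / \<mu>"
      using newton_step_error[OF C2 g0 stat coer[OF k1] near] \<mu> by (simp add: field_simps)
    \<comment> \<open>The new error splits into that of the exact Newton step, governed by
      \<open>\<epsilon>'\<close>, and the quadratically small deviation caused by
      inexactness.\<close>
    moreover have "norm (x (Suc k) - xstar) \<le> norm (x k + s' - xstar) + norm (s k - s')"
      using norm_triangle_ineq[of "x k + s' - xstar" "s k - s'"] by (simp add: Suc algebra_simps)
    ultimately show ?thesis by (simp add: algebra_simps power2_eq_square)
  qed

  \<comment> \<open>Superlinear convergence from continuity of the Hessian\<close>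
  have superlinear: "(\<lambda>k. norm (x (Suc k) - xstar)) \<in> o(\<lambda>k. norm (x k - xstar))"
    if \<tau>k: "\<forall>k. \<tau> k \<le> (norm (g (x k)))\<^sup>2"
  proof (rule landau_o.smallI)
    fix q :: real assume q: "q > 0"
    \<comment> \<open>The Newton error and the inexactness each get half of the factor
      \<open>q\<close>; the threshold \<open>\<epsilon>' / M\<^sup>2\<close> below serves the second
      half.\<close>
    define \<epsilon>' where "\<epsilon>' = q * \<mu> / 2"
    have \<epsilon>': "\<epsilon>' > 0" using q \<mu> by (simp add: \<epsilon>'_def)
    obtain \<delta>3 where \<delta>3: "\<delta>3 > 0" "\<And>z. norm (z - xstar) < \<delta>3 \<Longrightarrow> norm (B z - B xstar) < \<epsilon>' / 2"
      using hessian_continuity[OF C2, of "\<epsilon>' / 2"] \<epsilon>' by (metis half_gt_zero)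
    have contraction: "norm (x (Suc k) - xstar) \<le> q * norm (x k - xstar)"
      if k: "k \<ge> K0" and k3: "norm (x k - xstar) < \<delta>3" and k4: "norm (x k - xstar) < \<epsilon>' / M\<^sup>2" for k
    proof -
      have "norm (B (xstar + t *\<^sub>R (x k - xstar)) - B (x k)) \<le> \<epsilon>'" if "t \<in> {0..1}" for t
      proof -
        have "t * norm (x k - xstar) \<le> norm (x k - xstar)" using that by (simp add: mult_left_le_one_le)
        then have "norm (xstar + t *\<^sub>R (x k - xstar) - xstar) < \<delta>3" using k3 that by simp
        from \<delta>3(2)[OF this] \<delta>3(2)[OF k3] show ?thesis
          using norm_triangle_ineq4[of "B (xstar + t *\<^sub>R (x k - xstar)) - B xstar" "B (x k) - B xstar"]
          by simp
      qed
      from error_step[OF k \<tau>k[rule_format] this]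
      have "norm (x (Suc k) - xstar) \<le> norm (x k - xstar) * (\<epsilon>' / \<mu> + M\<^sup>2 / \<mu> * norm (x k - xstar))" .
      also have "\<dots> \<le> norm (x k - xstar) * q"
      proof (rule mult_left_mono)
        have "M\<^sup>2 * norm (x k - xstar) \<le> \<epsilon>'" using k4 M by (simp add: field_simps)
        then have "M\<^sup>2 * norm (x k - xstar) / \<mu> \<le> \<epsilon>' / \<mu>" using \<mu> by (intro divide_right_mono) auto
        moreover have "\<epsilon>' / \<mu> = q / 2" using \<mu> by (simp add: \<epsilon>'_def)
        moreover have "M\<^sup>2 / \<mu> * norm (x k - xstar) = M\<^sup>2 * norm (x k - xstar) / \<mu>" by simp
        ultimately show "\<epsilon>' / \<mu> + M\<^sup>2 / \<mu> * norm (x k - xstar) \<le> q" by linarith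
      qed simp
      finally show ?thesis by (simp add: mult.commute)
    qed
    have small: "\<epsilon>' / M\<^sup>2 > 0" using \<epsilon>' M by simp
    show "\<forall>\<^sub>F k in sequentially.
        norm (norm (x (Suc k) - xstar)) \<le> q * norm (norm (x k - xstar))"
      using eventually_ge_at_top[of K0] x_near[OF \<delta>3(1)] x_near[OF small]
      by eventually_elim (simp add: contraction)
  qed

  \<comment> \<open>Convergence of order \<open>1 + \<nu>\<close> from the Hoelder condition\<close>
  have rate: "\<exists>C>0. \<forall>\<^sub>F k in sequentially.
      norm (x (Suc k) - xstar) \<le> C * norm (x k - xstar) powr (1 + \<nu>)"
    if \<tau>k: "\<forall>k. \<tau> k \<le> (norm (g (x k)))\<^sup>2"
  proof -
    define C where "C = L / \<mu> + M\<^sup>2 / \<mu>"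
    have "C > 0" using L_pos \<mu> M by (simp add: C_def add_pos_pos)
    have bound: "norm (x (Suc k) - xstar) \<le> C * norm (x k - xstar) powr (1 + \<nu>)"
      if k: "k \<ge> K0" and k1: "norm (x k - xstar) < 1" for k
    proof -
      let ?e = "norm (x k - xstar)"
      \<comment> \<open>The gradient vanishes at \<open>xstar\<close> but not at \<open>x k\<close>,
        so \<open>powr\<close> is only applied to a positive error.\<close>
      have e: "?e > 0" using g_nz[of k] g0 by auto
      have "norm (B (xstar + t *\<^sub>R (x k - xstar)) - B (x k)) \<le> L * ?e powr \<nu>" if "t \<in> {0..1}" for t
      proof -
        have "xstar + t *\<^sub>R (x k - xstar) - x k = (t - 1) *\<^sub>R (x k - xstar)" by (simp add: algebra_simps)
        then have "norm (xstar + t *\<^sub>R (x k - xstar) - x k) \<le> ?e"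
          using that by (simp add: mult_left_le_one_le)
        then have "norm (xstar + t *\<^sub>R (x k - xstar) - x k) powr \<nu> \<le> ?e powr \<nu>"
          using nu by (intro powr_mono2) auto
        then have "L * norm (xstar + t *\<^sub>R (x k - xstar) - x k) powr \<nu> \<le> L * ?e powr \<nu>"
          using L_pos by simp
        then show ?thesis using hoelder unfolding hoelder_with_def by (meson order_trans)
      qed
      from error_step[OF k \<tau>k[rule_format] this]
      have "norm (x (Suc k) - xstar) \<le> ?e * (L * ?e powr \<nu> / \<mu> + M\<^sup>2 / \<mu> * ?e)" .
      also have "\<dots> \<le> ?e * (L * ?e powr \<nu> / \<mu> + M\<^sup>2 / \<mu> * ?e powr \<nu>)"
      proof -
        \<comment> \<open>Since the error is below 1 and \<open>\<nu>\<close> is at most 1, the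
          quadratic inexactness term is absorbed into order \<open>1 + \<nu>\<close>.\<close>
        have "?e powr 1 \<le> ?e powr \<nu>" using nu e k1 by (intro powr_mono') auto
        then show ?thesis using e \<mu> by (intro mult_left_mono add_left_mono) auto
      qed
      also have "\<dots> = C * ?e powr (1 + \<nu>)"
        using e by (simp add: C_def powr_add algebra_simps)
      finally show ?thesis .
    qed
    have "\<forall>\<^sub>F k in sequentially. norm (x (Suc k) - xstar) \<le> C * norm (x k - xstar) powr (1 + \<nu>)"
      using eventually_ge_at_top[of K0] x_near[OF zero_less_one]
      by eventually_elim (rule bound)
    with \<open>C > 0\<close> show ?thesis by blast
  qed

  show ?thesis
  \<comment> \<open>The lower bound is the radius at \<open>K1\<close>; the index \<open>K0\<close>
    may be later, since the steps must also have become shorter than that radius.\<close>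
  proof (rule exI[of _ K0], rule exI[of _ "\<Delta> K1"], intro conjI allI impI)
    show "\<Delta> K1 > 0" by (rule \<Delta>)
  next
    fix k assume "k \<ge> K0"
    then show "tr_ratio f g B (x k) (s k) \<ge> \<eta>2" "\<Delta> k \<ge> \<Delta> K1" "bij (B (x k))"
      using K1(2) \<Delta>_ge bij by (simp_all add: K0_def)
  next
    fix k s' assume *: "k \<ge> K0" "tr_solution f g B (x k) (\<Delta> k) s'"
    show "s' = - inv (B (x k)) (g (x k))" by (rule newton_inv[OF *])
    show "max (norm (s k)) (norm s') < \<Delta> k" using newton(1,2)[OF *] by simp
  next
    assume "\<nu> = 0 \<and> (\<forall>k. \<tau> k \<le> (norm (g (x k)))\<^sup>2)"
    then show "(\<lambda>k. norm (x (Suc k) - xstar)) \<in> o(\<lambda>k. norm (x k - xstar))"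
      using superlinear by blast
  next
    assume "\<nu> \<in> {0<..1} \<and> (\<forall>k. \<tau> k \<le> (norm (g (x k)))\<^sup>2)"
    then show "\<exists>C>0. \<forall>\<^sub>F k in sequentially.
        norm (x (Suc k) - xstar) \<le> C * norm (x k - xstar) powr (1 + \<nu>)"
      using rate by blast
  qed
qed

end
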